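(* Let $m,n,r,k$ be positive integers with $k\leq nr$. For a word in $C_m\wr S_n$, the number of $k$-error patterns which are correctible (i.e. contain at most $r$ errors in each block) is \[ E_{n,m,r}(k)=\sum_{\pi\in\mathcal{P}_{n,r}(k)}\ \prod_{i=1}^r \binom{n-c_i(\pi)}{f_i(\pi)}\binom{m}{i}^{f_i(\pi)}.\]
   Context: A word in $C_m\wr S_n$ (in list form) has length $mn$, and its positions $\{1,\ldots,mn\}$ are divided into $n$ consecutive blocks of $m$ positions each. A $k$-error pattern is a subset of $\{1,\ldots,mn\}$ of size $k$. It is called correctible if it contains no more than $r$ elements of each block. (In the decoding application $r=\lfloor\frac{m-1}{2}\rfloor$.) $\mathcal{P}_{n,r}(k)$ is the set of all partitions of the integer $k$ into at most $n$ parts, each part of size at most $r$. For $\pi\in\mathcal{P}_{n,r}(k)$, $f_i(\pi)$ is the number of parts of $\pi$ of size $i$, and $c_i(\pi)=\sum_{j=1}^{i-1}f_j(\pi)$ for $i\geq 2$, with $c_1(\pi)=0$. *)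

theory Defs
  imports "HOL-Combinatorics.Permutations" "HOL-Library.Multiset"
begin

text \<open>
  The wreath product $C_m \wr S_n$ in its imprimitive action on $\{1,\ldots,mn\}$: a permutation
  \<open>\<sigma>\<close> of the \<open>n\<close> blocks combined with an independent cyclic shift \<open>a j\<close> inside each block.
  Block indices and offsets are counted from 0 here, points from 1.
\<close>

definition wreath_perms :: "nat \<Rightarrow> nat \<Rightarrow> (nat \<Rightarrow> nat) set" where
  "wreath_perms m n = {g. g permutes {1..m * n} \<and>
     (\<exists>\<sigma> a. \<sigma> permutes {..<n} \<and>
        (\<forall>j<n. \<forall>t<m. g (j * m + t + 1) = \<sigma> j * m + (t + a j) mod m + 1))}"

definition wreath_words :: "nat \<Rightarrow> nat \<Rightarrow> nat list set" where
  "wreath_words m n = (\<lambda>g. map g [1..<m * n + 1]) ` wreath_perms m n"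

text \<open>Positions in words are numbered from 1, blocks are numbered \<open>1, \<dots>, n\<close>.\<close>

definition block :: "nat \<Rightarrow> nat \<Rightarrow> nat set" where
  "block m b = {(b - 1) * m + 1..b * m}"

definition error_patterns :: "nat list \<Rightarrow> nat \<Rightarrow> nat set set" where
  "error_patterns w k = {P. P \<subseteq> {1..length w} \<and> card P = k}"

definition correctible :: "nat \<Rightarrow> nat \<Rightarrow> nat \<Rightarrow> nat set \<Rightarrow> bool" where
  "correctible m n r P \<longleftrightarrow> (\<forall>b\<in>{1..n}. card (P \<inter> block m b) \<le> r)"

text \<open>A partition is the multiset of its (positive) parts.\<close>

definition partitions :: "nat \<Rightarrow> nat \<Rightarrow> nat \<Rightarrow> nat multiset set" where
  "partitions n r k = {p. sum_mset p = k \<and> size p \<le> n \<and> (\<forall>x\<in>#p. 1 \<le> x \<and> x \<le> r)}"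

text \<open>The number of parts of size less than \<open>i\<close>; the sum is empty for \<open>i = 1\<close>.\<close>

definition parts_below :: "nat multiset \<Rightarrow> nat \<Rightarrow> nat" where
  "parts_below p i = (\<Sum>j = 1..<i. count p j)"

text \<open>
  The set of partitions is finite, so sums over it are genuine. Moreover
  \<open>parts_below p i \<le> size p \<le> n\<close> for its members, so \<open>n - parts_below p i\<close> never truncates.
\<close>

lemma finite_partitions: "finite (partitions n r k)"
proof -
  have "partitions n r k \<subseteq> mset ` {xs. set xs \<subseteq> {..r} \<and> length xs \<le> n}"
  proof
    fix p assume p: "p \<in> partitions n r k"
    obtain xs where "p = mset xs" by (metis ex_mset)
    with p show "p \<in> mset ` {xs. set xs \<subseteq> {..r} \<and> length xs \<le> n}"
      by (auto simp: partitions_def)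
  qed
  then show ?thesis
    using finite_lists_length_le[of "{..r}" n] finite_surj by blast
qed

lemma parts_below_le:
  assumes "p \<in> partitions n r k"
  shows "parts_below p i \<le> n"
proof -
  have "parts_below p i = (\<Sum>j\<in>{1..<i} \<inter> set_mset p. count p j)"
    unfolding parts_below_def by (rule sum.mono_neutral_right) (auto simp: count_eq_zero_iff)
  also have "\<dots> \<le> (\<Sum>j\<in>set_mset p. count p j)"
    by (rule sum_mono2) auto
  also have "\<dots> = size p"
    by (simp add: size_multiset_overloaded_eq)
  finally show ?thesis
    using assms by (simp add: partitions_def)
qed

end

theory Submission imports Defs "HOL-Library.FuncSet" "HOL-Library.Disjoint_Sets" begin

text \<open>
  A word has length \<open>m * n\<close>, so its positions are the disjoint union of \<open>n\<close> blocks of size \<open>m\<close>, and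
  whether a pattern is correctible can be read off its profile, the function that sends each block
  to the number of errors in it.
  Two independent counts give the formula. A profile \<open>h\<close> is realised by
  \<open>\<Prod>b. m choose h b\<close> patterns, since the errors are placed in the blocks independently
  (\<open>card_subsets_with_profile\<close>); grouping equal factors turns this into the product of the
  \<open>(m choose i) ^ count p i\<close>, where \<open>p\<close> is the multiset of nonzero values of \<open>h\<close>. For a given
  partition \<open>p\<close>, the profiles with that multiset of nonzero values are built by choosing the blocks
  that have one error, then among the remaining blocks those that have two, and so on; when the
  blocks with \<open>i\<close> errors are chosen, \<open>parts_below p i\<close> blocks are already used
  (\<open>card_functions_with_fibre_sizes\<close>). All profiles with the same \<open>p\<close> are realised equally often, so
  the product of the two counts is the number of correctible patterns that belong to \<open>p\<close>.
\<close>

section \<open>Functions with prescribed fibre sizes\<close>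

definition functions_with_fibre_sizes ::
  "'a set \<Rightarrow> nat \<Rightarrow> (nat \<Rightarrow> nat) \<Rightarrow> ('a \<Rightarrow> nat) set" where
  "functions_with_fibre_sizes B r f =
     {h \<in> B \<rightarrow>\<^sub>E {..r}. \<forall>i\<in>{1..r}. card {b\<in>B. h b = i} = f i}"

lemma finite_functions_with_fibre_sizes:
  "finite B \<Longrightarrow> finite (functions_with_fibre_sizes B r f)"
  unfolding functions_with_fibre_sizes_def by (simp add: finite_PiE)

text \<open>
  In the recursion below, the zero fibre consists of the arguments that are still available for
  larger values.
\<close>

lemma card_zero_fibre:
  assumes "finite B" and h: "h \<in> functions_with_fibre_sizes B r f"
  shows "card {b\<in>B. h b = 0} = card B - (\<Sum>j = 1..<Suc r. f j)"
proof -
  have "h ` B \<subseteq> {..r}"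
    using h by (auto simp: functions_with_fibre_sizes_def)
  then have "card B = (\<Sum>i\<le>r. card {b\<in>B. h b = i})"
    using sum.group[OF assms(1), of "{..r}" h "\<lambda>_. 1::nat"] by simp
  also have "\<dots> = card {b\<in>B. h b = 0} + (\<Sum>i = 1..<Suc r. card {b\<in>B. h b = i})"
    by (simp add: atMost_atLeast0 sum.atLeast_Suc_atMost atLeastLessThanSuc_atLeastAtMost)
  also have "(\<Sum>i = 1..<Suc r. card {b\<in>B. h b = i}) = (\<Sum>j = 1..<Suc r. f j)"
    using h by (intro sum.cong) (auto simp: functions_with_fibre_sizes_def)
  finally show ?thesis by simp
qed

text \<open>
  A function into \<open>{..Suc r}\<close> arises in exactly one way from a function into \<open>{..r}\<close> by raising the
  value from 0 to \<open>Suc r\<close> on a set \<open>S\<close> of arguments; lowering the values \<open>Suc r\<close> to 0 is the inverse.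
  Extending the range at its upper end makes the fibres be chosen in increasing order of their
  values, which is the order that \<open>parts_below\<close> reflects.
\<close>

lemma bij_betw_raise_zeros:
  "bij_betw (\<lambda>(h, S) b. if b \<in> S then Suc r else h b)
     (SIGMA h : functions_with_fibre_sizes B r f.
        {S. S \<subseteq> {b\<in>B. h b = 0} \<and> card S = f (Suc r)})
     (functions_with_fibre_sizes B (Suc r) f)"
proof (rule bij_betwI[where g = "\<lambda>h. (\<lambda>b. if h b = Suc r \<and> b \<in> B then 0 else h b,
                                   {b\<in>B. h b = Suc r})"], goal_cases)
  case 1
  show ?case
  proof (safe, goal_cases)
    case (1 h S)
    have h: "h \<in> B \<rightarrow>\<^sub>E {..r}" and fib: "\<And>i. i \<in> {1..r} \<Longrightarrow> card {b\<in>B. h b = i} = f i"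
      using 1 by (auto simp: functions_with_fibre_sizes_def)
    let ?h = "\<lambda>b. if b \<in> S then Suc r else h b"
    have le: "h b \<le> r" if "b \<in> B" for b using h that by auto
    have low: "{b\<in>B. ?h b = i} = {b\<in>B. h b = i}" if "i \<in> {1..r}" for i
      using that 1 by auto
    have top: "{b\<in>B. ?h b = Suc r} = S"
      using 1(2) le by (auto split: if_splits dest: le)
    have "card {b\<in>B. ?h b = i} = f i" if i: "i \<in> {1..Suc r}" for i
    proof (cases "i = Suc r")
      case True
      show ?thesis unfolding True top by (rule 1(3))
    next
      case False
      with i have "i \<in> {1..r}" by simp
      then show ?thesis unfolding low[OF \<open>i \<in> {1..r}\<close>] by (rule fib)
    qed
    moreover have "?h \<in> B \<rightarrow>\<^sub>E {..Suc r}"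
      using 1 h le by (auto simp: PiE_iff extensional_def le_SucI)
    ultimately show ?case
      unfolding functions_with_fibre_sizes_def by blast
  qed
next
  case 2
  show ?case
  proof (safe, goal_cases)
    case (1 h)
    let ?h = "\<lambda>b. if h b = Suc r \<and> b \<in> B then 0 else h b"
    have h: "h \<in> B \<rightarrow>\<^sub>E {..Suc r}"
      and fib: "\<And>i. i \<in> {1..Suc r} \<Longrightarrow> card {b\<in>B. h b = i} = f i"
      using 1 by (auto simp: functions_with_fibre_sizes_def)
    have low: "{b\<in>B. ?h b = i} = {b\<in>B. h b = i}" if "i \<in> {1..r}" for i
      using that by auto
    have "card {b\<in>B. ?h b = i} = f i" if "i \<in> {1..r}" for i
      unfolding low[OF that] using that by (intro fib) simp
    moreover have "?h \<in> B \<rightarrow>\<^sub>E {..r}"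
      using h by (auto simp: PiE_iff extensional_def le_Suc_eq)
    ultimately show ?case
      unfolding functions_with_fibre_sizes_def by blast
  next
    case (2 h b) then show ?case by simp
  next
    case (3 h) then show ?case by (auto simp: functions_with_fibre_sizes_def)
  qed
next
  case (3 x)
  obtain h S where x: "x = (h, S)" by (cases x)
  have "h b \<noteq> Suc r" if "b \<in> B" for b
    using 3 x that by (force simp: functions_with_fibre_sizes_def PiE_iff)
  with 3 x show ?case
    by (auto simp: fun_eq_iff)
next
  case 4
  then show ?case by auto
qed

lemma card_functions_with_fibre_sizes:
  assumes "finite B"
  shows "card (functions_with_fibre_sizes B r f) =
    (\<Prod>i = 1..r. (card B - (\<Sum>j = 1..<i. f j)) choose f i)"
proof (induction r)
  case 0
  have "functions_with_fibre_sizes B 0 f = {\<lambda>b\<in>B. 0}"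
    by (auto simp: functions_with_fibre_sizes_def PiE_iff extensional_def fun_eq_iff)
  then show ?case by simp
next
  case (Suc r)
  let ?c = "card B - (\<Sum>j = 1..<Suc r. f j)"
  have "card (functions_with_fibre_sizes B (Suc r) f) =
    (\<Sum>h\<in>functions_with_fibre_sizes B r f.
       card {S. S \<subseteq> {b\<in>B. h b = 0} \<and> card S = f (Suc r)})"
    using bij_betw_same_card[OF bij_betw_raise_zeros[where B = B and r = r and f = f]] assms
    by (subst (asm) card_SigmaI) (auto simp: finite_functions_with_fibre_sizes)
  also have "\<dots> = (\<Sum>h\<in>functions_with_fibre_sizes B r f. ?c choose f (Suc r))"
  proof (rule sum.cong[OF refl])
    fix h assume "h \<in> functions_with_fibre_sizes B r f"
    from card_zero_fibre[OF assms this]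
    show "card {S. S \<subseteq> {b\<in>B. h b = 0} \<and> card S = f (Suc r)} = ?c choose f (Suc r)"
      using assms n_subsets[of "{b\<in>B. h b = 0}" "f (Suc r)"] by simp
  qed
  also have "\<dots> = card (functions_with_fibre_sizes B r f) * (?c choose f (Suc r))"
    by simp
  finally show ?case
    using Suc.IH by simp
qed

section \<open>Subsets with a prescribed profile\<close>

text \<open>The traces of a subset on disjoint sets can be chosen independently of each other.\<close>

lemma card_subsets_with_profile:
  assumes "finite B" and fin: "\<And>b. b \<in> B \<Longrightarrow> finite (A b)" and disj: "disjoint_family_on A B"
  shows "card {P. P \<subseteq> (\<Union>b\<in>B. A b) \<and> (\<forall>b\<in>B. card (P \<inter> A b) = h b)} =
    (\<Prod>b\<in>B. card (A b) choose h b)"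
proof -
  let ?L = "{P. P \<subseteq> (\<Union>b\<in>B. A b) \<and> (\<forall>b\<in>B. card (P \<inter> A b) = h b)}"
  let ?R = "\<Pi>\<^sub>E b\<in>B. {X. X \<subseteq> A b \<and> card X = h b}"
  have trace: "(\<Union>c\<in>B. F c) \<inter> A b = F b" if "F \<in> ?R" "b \<in> B" for F b
  proof -
    have "F c \<inter> A b = {}" if "c \<in> B" "c \<noteq> b" for c
      using that \<open>b \<in> B\<close> \<open>F \<in> ?R\<close> disj unfolding disjoint_family_on_def PiE_iff by blast
    moreover have "F b \<subseteq> A b" using that by (auto simp: PiE_iff)
    ultimately show ?thesis using \<open>b \<in> B\<close> by blast
  qed
  have "bij_betw (\<lambda>P. \<lambda>b\<in>B. P \<inter> A b) ?L ?R"
  proof (rule bij_betwI[where g = "\<lambda>F. \<Union>b\<in>B. F b"], goal_cases)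
    case 2
    show ?case
    proof
      fix F assume F: "F \<in> ?R"
      then have "card ((\<Union>c\<in>B. F c) \<inter> A b) = h b" if "b \<in> B" for b
        using trace[OF F that] that by (auto simp: PiE_iff)
      then show "(\<Union>b\<in>B. F b) \<in> ?L"
        using F by (auto simp: PiE_iff)
    qed
  next
    case (4 F)
    then show ?case
      using trace[OF 4] by (auto simp: fun_eq_iff PiE_iff extensional_def)
  qed auto
  then have "card ?L = card ?R"
    by (rule bij_betw_same_card)
  also have "\<dots> = (\<Prod>b\<in>B. card (A b) choose h b)"
    using assms by (simp add: card_PiE n_subsets)
  finally show ?thesis .
qed

section \<open>The partition given by a profile\<close>

definition nonzero_values :: "'a set \<Rightarrow> ('a \<Rightarrow> nat) \<Rightarrow> nat multiset" where
  "nonzero_values B h = {#x \<in># image_mset h (mset_set B). x \<noteq> 0#}"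

lemma count_nonzero_values:
  assumes "finite B"
  shows "count (nonzero_values B h) i = (if i = 0 then 0 else card {b\<in>B. h b = i})"
proof -
  have "{b \<in> B. i = h b} = {b \<in> B. h b = i}" by auto
  then show ?thesis
    using assms by (simp add: nonzero_values_def count_image_mset' Int_def conj_commute)
qed

lemma sum_mset_nonzero_values: "sum_mset (nonzero_values B h) = (\<Sum>b\<in>B. h b)"
proof -
  have "sum_mset {#x \<in># M. x \<noteq> 0#} = sum_mset M" for M :: "nat multiset"
    by (induction M) auto
  then show ?thesis
    by (simp add: nonzero_values_def sum_unfold_sum_mset)
qed

lemma nonzero_values_in_partitions:
  assumes "finite B" "h \<in> B \<rightarrow>\<^sub>E {..r}"
  shows "nonzero_values B h \<in> partitions (card B) r (\<Sum>b\<in>B. h b)"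
proof -
  have "size (nonzero_values B h) \<le> card B"
    using size_filter_mset_lesseq[of "\<lambda>x. x \<noteq> 0" "image_mset h (mset_set B)"]
    by (simp add: nonzero_values_def)
  moreover have "1 \<le> x \<and> x \<le> r" if "x \<in># nonzero_values B h" for x
    using that assms by (auto simp: nonzero_values_def)
  ultimately show ?thesis
    by (simp add: partitions_def sum_mset_nonzero_values)
qed

text \<open>
  The fibre sizes over \<open>{1..r}\<close> and the multiset of nonzero values determine each other, because
  neither the profile nor the partition has values above \<open>r\<close>. The sum \<open>k\<close> of the profile is then
  the sum of the parts.
\<close>

lemma profiles_of_partition:
  assumes "finite B" and p: "p \<in> partitions n r k"
  shows "{h \<in> {h \<in> B \<rightarrow>\<^sub>E {..r}. (\<Sum>b\<in>B. h b) = k}. nonzero_values B h = p} =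
    functions_with_fibre_sizes B r (count p)"
proof -
  have backward: "nonzero_values B h = p"
    if h: "h \<in> B \<rightarrow>\<^sub>E {..r}" and fib: "\<forall>i\<in>{1..r}. card {b\<in>B. h b = i} = count p i" for h
  proof (rule multiset_eqI)
    fix i
    show "count (nonzero_values B h) i = count p i"
    proof (cases "i \<in> {1..r}")
      case True
      then show ?thesis using fib assms by (simp add: count_nonzero_values)
    next
      case False
      then have "i \<notin># p" using p by (auto simp: partitions_def)
      moreover have "i \<notin># nonzero_values B h"
        using False h \<open>finite B\<close> by (auto simp: nonzero_values_def)
      ultimately show ?thesis by (simp add: not_in_iff)
    qed
  qed
  have total: "(\<Sum>b\<in>B. h b) = k" if "nonzero_values B h = p" for h
    using that p sum_mset_nonzero_values[of B h] by (simp add: partitions_def)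
  have forward: "\<forall>i\<in>{1..r}. card {b\<in>B. h b = i} = count p i" if "nonzero_values B h = p" for h
    using count_nonzero_values[OF assms(1), of h] unfolding that by simp
  show ?thesis
    unfolding functions_with_fibre_sizes_def using backward forward total by blast
qed

text \<open>
  Blocks without errors contribute the factor \<open>m choose 0 = 1\<close>, so the product over all blocks
  sees only the partition.
\<close>

lemma prod_binomial_of_profile:
  assumes "finite B" and h: "h \<in> functions_with_fibre_sizes B r f"
  shows "(\<Prod>b\<in>B. m choose h b) = (\<Prod>i = 1..r. (m choose i) ^ f i)"
proof -
  have "h ` B \<subseteq> {..r}"
    using h by (auto simp: functions_with_fibre_sizes_def)
  from prod.group[OF assms(1) _ this, of "\<lambda>b. m choose h b"]
  have "(\<Prod>b\<in>B. m choose h b) = (\<Prod>i\<le>r. \<Prod>b\<in>{b\<in>B. h b = i}. m choose h b)"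
    by simp
  also have "\<dots> = (\<Prod>i\<le>r. (m choose i) ^ card {b\<in>B. h b = i})"
    by (intro prod.cong) auto
  also have "\<dots> = (\<Prod>i = 1..r. (m choose i) ^ card {b\<in>B. h b = i})"
    by (simp add: atMost_atLeast0 prod.atLeast_Suc_atMost)
  also have "\<dots> = (\<Prod>i = 1..r. (m choose i) ^ f i)"
    using h by (intro prod.cong) (auto simp: functions_with_fibre_sizes_def)
  finally show ?thesis .
qed

section \<open>Subsets with bounded traces on disjoint sets of equal size\<close>

text \<open>
  The subsets are sorted first by profile and then by the partition that the profile gives. Within
  one partition every profile contributes the same number of subsets, so the inner sum is a product
  of the two counts above.
\<close>

theorem card_subsets_with_bounded_traces:
  assumes "finite B" and fin: "\<And>b. b \<in> B \<Longrightarrow> finite (A b)" and disj: "disjoint_family_on A B"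
    and m: "\<And>b. b \<in> B \<Longrightarrow> card (A b) = m"
  shows "card {P. P \<subseteq> (\<Union>b\<in>B. A b) \<and> card P = k \<and> (\<forall>b\<in>B. card (P \<inter> A b) \<le> r)} =
    (\<Sum>p\<in>partitions (card B) r k. \<Prod>i = 1..r.
       ((card B - parts_below p i) choose count p i) * (m choose i) ^ count p i)"
proof -
  let ?E = "{P. P \<subseteq> (\<Union>b\<in>B. A b) \<and> card P = k \<and> (\<forall>b\<in>B. card (P \<inter> A b) \<le> r)}"
  let ?profile = "\<lambda>P. \<lambda>b\<in>B. card (P \<inter> A b)"
  let ?H = "{h \<in> B \<rightarrow>\<^sub>E {..r}. (\<Sum>b\<in>B. h b) = k}"
  let ?part = "nonzero_values B"
  have fin_union: "finite (\<Union>b\<in>B. A b)" using assms by blast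
  have finE: "finite ?E" using fin_union by simp
  have finH: "finite ?H" using assms(1) by (simp add: finite_PiE)
  have card_traces: "card P = (\<Sum>b\<in>B. card (P \<inter> A b))" if "P \<subseteq> (\<Union>b\<in>B. A b)" for P
  proof -
    have "P = (\<Union>b\<in>B. P \<inter> A b)" using that by blast
    then have "card P = card (\<Union>b\<in>B. P \<inter> A b)" by simp
    also have "\<dots> = (\<Sum>b\<in>B. card (P \<inter> A b))"
      using assms(1) fin disj by (intro card_UN_disjoint) (auto simp: disjoint_family_on_def)
    finally show ?thesis .
  qed
  have profile: "?profile ` ?E \<subseteq> ?H"
    using card_traces by auto
  have part: "?part ` ?H \<subseteq> partitions (card B) r k"
    using nonzero_values_in_partitions[OF assms(1)] by blast
  have "card ?E = (\<Sum>h\<in>?H. card {P\<in>?E. ?profile P = h})"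
    using sum.group[OF finE finH profile, of "\<lambda>_. 1::nat"] by simp
  also have "\<dots> = (\<Sum>h\<in>?H. \<Prod>b\<in>B. m choose h b)"
  proof (rule sum.cong[OF refl])
    fix h assume h: "h \<in> ?H"
    have "{P\<in>?E. ?profile P = h} = {P. P \<subseteq> (\<Union>b\<in>B. A b) \<and> (\<forall>b\<in>B. card (P \<inter> A b) = h b)}"
    proof (intro set_eqI iffI; clarsimp, goal_cases)
      case (1 P)
      with h card_traces[OF 1(1)] show ?case
        by (auto simp: PiE_iff extensional_def fun_eq_iff)
    qed
    then show "card {P\<in>?E. ?profile P = h} = (\<Prod>b\<in>B. m choose h b)"
      using card_subsets_with_profile[OF assms(1) fin disj, of h] m by simp
  qed
  also have "\<dots> = (\<Sum>p\<in>partitions (card B) r k. \<Sum>h\<in>{h\<in>?H. ?part h = p}. \<Prod>b\<in>B. m choose h b)"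
    by (rule sum.group[OF finH finite_partitions part, symmetric])
  also have "\<dots> = (\<Sum>p\<in>partitions (card B) r k. \<Prod>i = 1..r.
       ((card B - parts_below p i) choose count p i) * (m choose i) ^ count p i)"
  proof (rule sum.cong[OF refl])
    fix p assume "p \<in> partitions (card B) r k"
    then have "(\<Sum>h\<in>{h\<in>?H. ?part h = p}. \<Prod>b\<in>B. m choose h b) =
      (\<Sum>h\<in>functions_with_fibre_sizes B r (count p). \<Prod>b\<in>B. m choose h b)"
      by (simp only: profiles_of_partition[OF assms(1)])
    also have "\<dots> = card (functions_with_fibre_sizes B r (count p)) *
        (\<Prod>i = 1..r. (m choose i) ^ count p i)"
      by (simp add: prod_binomial_of_profile[OF assms(1)])
    also have "\<dots> = (\<Prod>i = 1..r.
       ((card B - parts_below p i) choose count p i) * (m choose i) ^ count p i)"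
      by (simp only: card_functions_with_fibre_sizes[OF assms(1)] prod.distrib parts_below_def)
    finally show "(\<Sum>h\<in>{h\<in>?H. ?part h = p}. \<Prod>b\<in>B. m choose h b) = \<dots>" .
  qed
  finally show ?thesis .
qed

section \<open>Blocks of positions\<close>

lemma disjoint_blocks: "disjoint_family_on (block m) {1..n}"
proof -
  have "block m b \<inter> block m c = {}" if "b < c" for b c
  proof -
    have "b * m \<le> (c - 1) * m"
      using that by (intro mult_le_mono1) simp
    then have "x \<le> (c - 1) * m" if "x \<le> b * m" for x
      using that by (rule order.trans[rotated])
    then show ?thesis by (fastforce simp: block_def)
  qed
  then show ?thesis
    unfolding disjoint_family_on_def by (metis Int_commute linorder_neqE_nat)
qed

lemma card_block: "b \<ge> 1 \<Longrightarrow> card (block m b) = m"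
  by (cases b) (simp_all add: block_def)

lemma union_blocks: "(\<Union>b\<in>{1..n}. block m b) = {1..m * n}"
proof (induction n)
  case (Suc n)
  have "(\<Union>b\<in>{1..Suc n}. block m b) = {1..m * n} \<union> block m (Suc n)"
    using Suc by (simp add: atLeastAtMostSuc_conv Un_commute)
  also have "\<dots> = {1..m * Suc n}"
    by (auto simp: block_def algebra_simps)
  finally show ?case .
qed simp

theorem proposition8:
  fixes m n r k :: nat and w :: "nat list"
  assumes "m > 0" and "n > 0" and "r > 0" and "k > 0"
    and "k \<le> n * r"
    and "w \<in> wreath_words m n"
  shows "card {P \<in> error_patterns w k. correctible m n r P} =
    (\<Sum>p\<in>partitions n r k. \<Prod>i = 1..r.
       ((n - parts_below p i) choose count p i) * (m choose i) ^ count p i)"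
proof -
  have "length w = m * n"
    using assms(6) by (auto simp: wreath_words_def)
  then have patterns: "{P \<in> error_patterns w k. correctible m n r P} =
    {P. P \<subseteq> (\<Union>b\<in>{1..n}. block m b) \<and> card P = k \<and> (\<forall>b\<in>{1..n}. card (P \<inter> block m b) \<le> r)}"
    unfolding union_blocks by (auto simp: error_patterns_def correctible_def)
  have "card {P. P \<subseteq> (\<Union>b\<in>{1..n}. block m b) \<and> card P = k \<and>
      (\<forall>b\<in>{1..n}. card (P \<inter> block m b) \<le> r)} =
    (\<Sum>p\<in>partitions (card {1..n}) r k. \<Prod>i = 1..r.
       ((card {1..n} - parts_below p i) choose count p i) * (m choose i) ^ count p i)"
  proof (rule card_subsets_with_bounded_traces)
    show "finite (block m b)" for b by (simp add: block_def)
    show "card (block m b) = m" if "b \<in> {1..n}" for b using that by (simp add: card_block)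
  qed (simp, rule disjoint_blocks)
  then show ?thesis
    unfolding patterns card_atLeastAtMost diff_Suc_1 .
qed

end
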